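(* Let $\lambda\ge0$, let $n\ge1$ be an integer, let $f(\alpha)=e^{-\lambda\alpha}$, and let $\{L_k=(A_k,\pi_k,C_k)\}_{k\ge1}$ and $\{S_k\}_{k\ge1}$ be the sequences of latent samples and samples produced by the R-TBS algorithm for exponential decay with decay rate $\lambda$ and maximum sample size $n$. Let $W_k=\sum_{i=1}^k|\mathcal{B}_i|f(\alpha_{i,k})$ be the total weight at time $t_k$ and define $\rho_k=\min(1,n/W_k)$. Then: (i) $\Pr[x\in S_k]=\rho_kf(\alpha_{i,k})$ for all $k\ge1$, $i\le k$, and $x\in\mathcal{B}_i$; (ii) $C_k=\rho_kW_k$ for all $k\ge1$; and (iii) $\rho_kf(\alpha_{i,k})\le\rho_{k-1}f(\alpha_{i,k-1})$ for all $k>1$ and $i<k$.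
   Context: Setting. $\mathcal{B}_1,\mathcal{B}_2,\ldots$ is a given sequence of pairwise disjoint finite sets of items (possibly empty); batch $\mathcal{B}_k$ arrives at time $t_k=k\Delta$, $\Delta>0$ fixed, and $t_0=0$. For $i\le k$, $\alpha_{i,k}=t_k-t_i$ is the age at time $t_k$ of items of $\mathcal{B}_i$. Write $\operatorname{frac}(x)=x-\lfloor x\rfloor$. Convention: $n/0=\infty$. Latent samples. A latent sample of a set $U$ with sample weight $C\ge0$ is a triple $L=(A,\pi,C)$ with $A\subseteq U$ a set of $\lfloor C\rfloor$ "full" items and $\pi\subseteq U$ (disjoint from $A$) a set with at most one "partial" item, nonempty iff $C>\lfloor C\rfloor$. GETSAMPLE$(A,\pi,C)$: draw $U$ uniform on $[0,1]$; return $A\cup\pi$ if $U\le\operatorname{frac}(C)$, else return $A$. Below, SAMPLE$(A,m)$ is a uniform random subset of $A$ of size $\min(m,|A|)$. SWAP1$(A,\pi)$: draw $I=$ SAMPLE$(A,1)$ and return $((A\setminus I)\cup\pi,\ I)$. MOVE1$(A,\pi)$: draw $I=$ SAMPLE$(A,1)$ and return $(A\setminus I,\ I)$. DOWNSAMPLE$((A,\pi,C),\theta)$ for $\theta\in(0,1)$: set $C'=\theta C$, draw $U$ uniform on $[0,1]$, start with $(A',\pi')=(A,\pi)$. - If $\lfloor C'\rfloor=0$: if $U>\operatorname{frac}(C)/C$ set $(A',\pi')=$ SWAP1$(A,\pi)$; then set $A'=\emptyset$. - Else if $\lfloor C'\rfloor=\lfloor C\rfloor$: if $U>(1-\theta\operatorname{frac}(C))/(1-\operatorname{frac}(C'))$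 set $(A',\pi')=$ SWAP1$(A,\pi)$. - Else ($0<\lfloor C'\rfloor<\lfloor C\rfloor$): if $U\le\theta\operatorname{frac}(C)$ set $A'=$ SAMPLE$(A,\lfloor C'\rfloor)$ and then $(A',\pi')=$ SWAP1$(A',\pi)$; otherwise set $A'=$ SAMPLE$(A,\lfloor C'\rfloor+1)$ and then $(A',\pi')=$ MOVE1$(A',\pi)$. Finally, if $C'$ is an integer set $\pi'=\emptyset$. Return $(A',\pi',C')$. For $\theta=1$ the input is returned unchanged, and the empty latent sample $(\emptyset,\emptyset,0)$ is always returned unchanged. UNION$((A_1,\pi_1,C_1),(A_2,\pi_2,C_2))$ for disjoint latent samples: set $C=C_1+C_2$, $a=\operatorname{frac}(C_1)$, $b=\operatorname{frac}(C_2)$, draw $U$ uniform on $[0,1]$. - If $a+b<1$: $A=A_1\cup A_2$; $\pi=\pi_1$ if $U\le a/(a+b)$, else $\pi=\pi_2$ (if $a=b=0$, $\pi=\emptyset$). - If $a+b=1$: $\pi=\emptyset$; $A=A_1\cup A_2\cup\pi_1$ if $U\le a$, else $A=A_1\cup A_2\cup\pi_2$. - If $a+b>1$: if $U\le(1-a)/[(1-a)+(1-b)]$ then $\pi=\pi_1$, $A=A_1\cup A_2\cup\pi_2$; else $\pi=\pi_2$, $A=A_1\cup A_2\cup\pi_1$. Return $(A,\pi,C)$. R-TBS for exponential decay (decay rate $\lambda\ge0$, maximum sample size $n$). Initialize $W=0$, latent sample $L=(\emptyset,\emptyset,0)$, $\rho=1$. For $k=1,2,\ldots$: set $\theta=e^{-\lambda(t_k-t_{k-1})}$;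 $W\leftarrow\theta W+|\mathcal{B}_k|$; $\rho'\leftarrow\rho$; $\rho\leftarrow\min(1,n/W)$; if the weight of $L$ is positive, $L\leftarrow$ DOWNSAMPLE$(L,(\rho/\rho')\theta)$; $L_0\leftarrow$ DOWNSAMPLE$((\mathcal{B}_k,\emptyset,|\mathcal{B}_k|),\rho)$; $L\leftarrow$ UNION$(L_0,L)$; denote this latent sample by $L_k=(A_k,\pi_k,C_k)$; output $S_k=$ GETSAMPLE$(L_k)$. All random draws are mutually independent. *)

theory Defs
  imports "HOL-Probability.Probability"
begin

text \<open>
  The algorithms are written in the PMF monad, so successive draws are independent.
  A uniform variate \<open>U\<close> on \<open>[0,1]\<close> is only ever compared, once, with a threshold;
  \<open>uniform_le t\<close> is the law of the outcome of the test \<open>U \<le> t\<close>.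
  Note that \<open>bernoulli_pmf\<close> clamps its argument to \<open>[0,1]\<close>, in agreement with
  the lemma below, which holds for every real \<open>t\<close>.
\<close>

definition uniform_le :: "real \<Rightarrow> bool pmf" where
  "uniform_le t = bernoulli_pmf t"

lemma measure_pmf_uniform_le:
  "measure_pmf (uniform_le t) =
     distr (uniform_measure lborel {0..1::real}) (count_space UNIV) (\<lambda>u. u \<le> t)"
proof -
  let ?U = "uniform_measure lborel {0..1::real}"
  let ?D = "distr ?U (count_space UNIV) (\<lambda>u. u \<le> t)"
  interpret U: prob_space ?U
    by (rule prob_space_uniform_measure) auto
  have meas: "(\<lambda>u::real. u \<le> t) \<in> measurable ?U (count_space UNIV)"
    by measurable
  interpret D: prob_space ?D
    by (rule U.prob_space_distr[OF meas])
  have T: "measure ?D {True} = min 1 (max 0 t)"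
  proof -
    have "measure ?D {True} = measure ?U {..t}"
      by (simp add: measure_distr[OF meas] vimage_def atMost_def)
    also have "\<dots> = measure lborel ({0..1} \<inter> {..t}) / measure lborel {0..1::real}"
      by (rule measure_uniform_measure) auto
    also have "{0..1} \<inter> {..t} = {0..min 1 t}"
      by auto
    finally show ?thesis
      by (auto simp: min_def max_def)
  qed
  have F: "measure ?D {False} = 1 - min 1 (max 0 t)"
  proof -
    have "measure ?D (space ?D - {True}) = 1 - measure ?D {True}"
      by (rule D.prob_compl) auto
    moreover have "space ?D - {True} = {False}"
      by auto
    ultimately show ?thesis
      using T by simp
  qed
  show ?thesis
  proof (rule measure_eqI_finite[where A = UNIV])
    fix b :: bool
    have "emeasure (measure_pmf (uniform_le t)) {b} = ennreal (pmf (bernoulli_pmf t) b)"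
      by (simp add: uniform_le_def emeasure_pmf_single)
    also have "pmf (bernoulli_pmf t) b = measure ?D {b}"
      using T F by (cases b) (simp_all add: bernoulli_pmf.rep_eq)
    finally show "emeasure (measure_pmf (uniform_le t)) {b} = emeasure ?D {b}"
      by (simp add: D.emeasure_eq_measure)
  qed simp_all
qed

text \<open>A latent sample \<open>(A, \<pi>, C)\<close>: full items, partial item (if any), sample weight.\<close>

type_synonym 'a latent = "'a set \<times> 'a set \<times> real"

definition get_sample :: "'a latent \<Rightarrow> 'a set pmf" where
  "get_sample = (\<lambda>(A, \<pi>, C). do {
     u \<leftarrow> uniform_le (frac C);
     return_pmf (if u then A \<union> \<pi> else A)
   })"

definition sample :: "'a set \<Rightarrow> nat \<Rightarrow> 'a set pmf" where
  "sample A m = pmf_of_set {I. I \<subseteq> A \<and> card I = min m (card A)}"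

definition swap1 :: "'a set \<Rightarrow> 'a set \<Rightarrow> ('a set \<times> 'a set) pmf" where
  "swap1 A \<pi> = do {
     I \<leftarrow> sample A 1;
     return_pmf ((A - I) \<union> \<pi>, I)
   }"

definition move1 :: "'a set \<Rightarrow> 'a set \<Rightarrow> ('a set \<times> 'a set) pmf" where
  "move1 A \<pi> = do {
     I \<leftarrow> sample A 1;
     return_pmf (A - I, I)
   }"

definition downsample :: "'a latent \<Rightarrow> real \<Rightarrow> 'a latent pmf" where
  "downsample = (\<lambda>(A, \<pi>, C) \<theta>.
     if \<theta> = 1 \<or> (A, \<pi>, C) = ({}, {}, 0) then return_pmf (A, \<pi>, C)
     else let C' = \<theta> * C in do {
       (A', \<pi>') \<leftarrow>
         (if \<lfloor>C'\<rfloor> = 0 then do {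
            u \<leftarrow> uniform_le (frac C / C);
            (A', \<pi>') \<leftarrow> (if \<not> u then swap1 A \<pi> else return_pmf (A, \<pi>));
            return_pmf ({}, \<pi>')
          }
          else if \<lfloor>C'\<rfloor> = \<lfloor>C\<rfloor> then do {
            u \<leftarrow> uniform_le ((1 - \<theta> * frac C) / (1 - frac C'));
            if \<not> u then swap1 A \<pi> else return_pmf (A, \<pi>)
          }
          else do {
            u \<leftarrow> uniform_le (\<theta> * frac C);
            if u then do {
              A' \<leftarrow> sample A (nat \<lfloor>C'\<rfloor>);
              swap1 A' \<pi>
            }
            else do {
              A' \<leftarrow> sample A (nat \<lfloor>C'\<rfloor> + 1);
              move1 A' \<pi>
            }
          });
       return_pmf (A', if C' \<in> \<int> then {} else \<pi>', C')
     })"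

definition union_latent :: "'a latent \<Rightarrow> 'a latent \<Rightarrow> 'a latent pmf" where
  "union_latent = (\<lambda>(A1, \<pi>1, C1) (A2, \<pi>2, C2).
     let C = C1 + C2; a = frac C1; b = frac C2 in
     if a + b < 1 then
       (if a = 0 \<and> b = 0 then return_pmf (A1 \<union> A2, {}, C)
        else do {
          u \<leftarrow> uniform_le (a / (a + b));
          return_pmf (A1 \<union> A2, if u then \<pi>1 else \<pi>2, C)
        })
     else if a + b = 1 then do {
       u \<leftarrow> uniform_le a;
       return_pmf (A1 \<union> A2 \<union> (if u then \<pi>1 else \<pi>2), {}, C)
     }
     else do {
       u \<leftarrow> uniform_le ((1 - a) / ((1 - a) + (1 - b)));
       return_pmf (if u then (A1 \<union> A2 \<union> \<pi>2, \<pi>1, C) else (A1 \<union> A2 \<union> \<pi>1, \<pi>2, C))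
     })"

definition batch_time :: "real \<Rightarrow> nat \<Rightarrow> real" where
  "batch_time \<Delta> k = real k * \<Delta>"

definition age :: "real \<Rightarrow> nat \<Rightarrow> nat \<Rightarrow> real" where
  "age \<Delta> i k = batch_time \<Delta> k - batch_time \<Delta> i"

definition decay :: "real \<Rightarrow> real \<Rightarrow> real" where
  "decay lam \<alpha> = exp (- lam * \<alpha>)"

text \<open>\<open>min 1 (n / W)\<close> under the convention \<open>n / 0 = \<infinity>\<close>.\<close>

definition cap_ratio :: "nat \<Rightarrow> real \<Rightarrow> real" where
  "cap_ratio n W = (if W = 0 then 1 else min 1 (real n / W))"

definition total_weight :: "real \<Rightarrow> real \<Rightarrow> (nat \<Rightarrow> 'a set) \<Rightarrow> nat \<Rightarrow> real" where
  "total_weight lam \<Delta> B k = (\<Sum>i = 1..k. real (card (B i)) * decay lam (age \<Delta> i k))"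

definition rho :: "real \<Rightarrow> nat \<Rightarrow> real \<Rightarrow> (nat \<Rightarrow> 'a set) \<Rightarrow> nat \<Rightarrow> real" where
  "rho lam n \<Delta> B k = cap_ratio n (total_weight lam \<Delta> B k)"

text \<open>
  \<open>rtbs_state lam n \<Delta> B k\<close> is the law of the loop variables \<open>(W, \<rho>, L)\<close> after the
  \<open>k\<close>-th iteration. Batches are indexed from 1; \<open>B 0\<close> is never used.
\<close>

definition rtbs_step ::
  "real \<Rightarrow> nat \<Rightarrow> real \<Rightarrow> (nat \<Rightarrow> 'a set) \<Rightarrow> nat \<Rightarrow>
     real \<times> real \<times> 'a latent \<Rightarrow> (real \<times> real \<times> 'a latent) pmf" where
  "rtbs_step lam n \<Delta> B k = (\<lambda>(W, \<rho>', L).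
     let \<theta> = exp (- lam * (batch_time \<Delta> k - batch_time \<Delta> (k - 1)));
         W' = \<theta> * W + real (card (B k));
         \<rho> = cap_ratio n W' in do {
       L1 \<leftarrow> (if snd (snd L) > 0 then downsample L (\<rho> / \<rho>' * \<theta>) else return_pmf L);
       L0 \<leftarrow> downsample (B k, {}, real (card (B k))) \<rho>;
       L' \<leftarrow> union_latent L0 L1;
       return_pmf (W', \<rho>, L')
     })"

primrec rtbs_state ::
  "real \<Rightarrow> nat \<Rightarrow> real \<Rightarrow> (nat \<Rightarrow> 'a set) \<Rightarrow> nat \<Rightarrow> (real \<times> real \<times> 'a latent) pmf" where
  "rtbs_state lam n \<Delta> B 0 = return_pmf (0, 1, ({}, {}, 0))"
| "rtbs_state lam n \<Delta> B (Suc k) = rtbs_state lam n \<Delta> B k \<bind> rtbs_step lam n \<Delta> B (Suc k)"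

text \<open>The joint law of \<open>(L\<^sub>k, S\<^sub>k)\<close>.\<close>

definition rtbs ::
  "real \<Rightarrow> nat \<Rightarrow> real \<Rightarrow> (nat \<Rightarrow> 'a set) \<Rightarrow> nat \<Rightarrow> ('a latent \<times> 'a set) pmf" where
  "rtbs lam n \<Delta> B k = do {
     (W, \<rho>, L) \<leftarrow> rtbs_state lam n \<Delta> B k;
     S \<leftarrow> get_sample L;
     return_pmf (L, S)
   }"

end

theory Submission
  imports Defs
begin

text \<open>
  Count a full item with weight 1 and the partial item with weight \<open>frac C\<close>: this is the
  probability, given the latent sample, that the item enters the output of \<open>get_sample\<close>.
  The expectation of this quantity is linear in the steps of the algorithm: downsampling by
  \<open>\<theta>\<close> multiplies it by \<open>\<theta>\<close>, and the union of disjoint latent samples adds it up. In step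
  \<open>k + 1\<close> an old item is therefore multiplied by \<open>(\<rho>\<^sub>k\<^sub>+\<^sub>1 / \<rho>\<^sub>k) e\<^sup>-\<^sup>\<lambda>\<^sup>\<Delta>\<close>, which is at most 1 because
  the total weight decays by no more than this exponential factor, and a new item gets
  \<open>\<rho>\<^sub>k\<^sub>+\<^sub>1\<close>; the products telescope. Sample weights obey the same recursion deterministically.
\<close>

subsection \<open>Expectations over the elementary draws\<close>

text \<open>The bind law is unconditional for nonnegative integrals. Boundedness makes every Bochner
  integral involved finite, so both sides can be compared after embedding into
  \<open>ennreal\<close>.\<close>

lemma expectation_bind_pmf:
  fixes h :: "'b \<Rightarrow> real"
  assumes h: "\<And>y. 0 \<le> h y" "\<And>y. h y \<le> c"
  shows "measure_pmf.expectation (bind_pmf p f) h =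
    measure_pmf.expectation p (\<lambda>x. measure_pmf.expectation (f x) h)"
proof -
  have int: "integrable (measure_pmf q) h" for q :: "'b pmf"
    by (rule measure_pmf.integrable_const_bound[where B = c]) (use h in auto)
  have bnd: "0 \<le> measure_pmf.expectation q h \<and> measure_pmf.expectation q h \<le> c" for q :: "'b pmf"
    using h int[of q] by (auto intro!: integral_nonneg measure_pmf.integral_le_const)
  have int': "integrable (measure_pmf p) (\<lambda>x. measure_pmf.expectation (f x) h)"
    by (rule measure_pmf.integrable_const_bound[where B = c]) (use bnd in auto)
  have "ennreal (measure_pmf.expectation (bind_pmf p f) h) = (\<integral>\<^sup>+y. ennreal (h y) \<partial>bind_pmf p f)"
    by (subst nn_integral_eq_integral[OF int]) (use h in auto)
  also have "\<dots> = (\<integral>\<^sup>+x. ennreal (measure_pmf.expectation (f x) h) \<partial>p)"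
    by (simp add: nn_integral_eq_integral[OF int] h)
  also have "\<dots> = ennreal (measure_pmf.expectation p (\<lambda>x. measure_pmf.expectation (f x) h))"
    by (subst nn_integral_eq_integral[OF int']) (use bnd in auto)
  finally show ?thesis
    using bnd by (subst (asm) ennreal_inj) (auto intro!: integral_nonneg)
qed

lemma expectation_cong_pmf:
  fixes h g :: "'a \<Rightarrow> real"
  assumes "\<And>y. y \<in> set_pmf p \<Longrightarrow> h y = g y"
  shows "measure_pmf.expectation p h = measure_pmf.expectation p g"
  by (rule integral_cong_AE) (use assms in \<open>auto simp: AE_measure_pmf_iff\<close>)

lemma set_pmf_sample:
  assumes "finite A" "m \<le> card A"
  shows "set_pmf (sample A m) = {I. I \<subseteq> A \<and> card I = m}"
proof -
  obtain I where "I \<subseteq> A" "card I = m"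
    using obtain_subset_with_card_n[OF assms(2)] by metis
  then show ?thesis
    using assms unfolding sample_def by (subst set_pmf_of_set) auto
qed

text \<open>By symmetry, a fixed item of \<open>A\<close> lies in a uniform \<open>m\<close>-subset
  with probability \<open>m / card A\<close>. The affine integrand is the shape to which swapping
  and moving reduce below.\<close>

lemma expectation_sample:
  assumes "finite A" "m \<le> card A"
  shows "measure_pmf.expectation (sample A m) (\<lambda>I. a * indicat_real I x + b)
    = a * (real m / real (card A)) * indicat_real A x + b"
proof -
  let ?S = "{I. I \<subseteq> A \<and> card I = m}"
  have fin: "finite ?S" using assms by auto
  have ne: "?S \<noteq> {}"
    using obtain_subset_with_card_n[OF assms(2)] by fastforce
  have S: "sample A m = pmf_of_set ?S"
    using assms by (simp add: sample_def min_def)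
  have int: "integrable (measure_pmf (sample A m)) g" for g :: "_ \<Rightarrow> real"
    by (rule integrable_measure_pmf_finite) (simp add: set_pmf_sample[OF assms] fin)
  have "measure_pmf.expectation (sample A m) (\<lambda>I. indicat_real I x)
      = real m / real (card A) * indicat_real A x"
  proof (cases "x \<in> A")
    case False
    have "measure_pmf.expectation (sample A m) (\<lambda>I. indicat_real I x) =
        measure_pmf.expectation (sample A m) (\<lambda>I. 0)"
      by (rule expectation_cong_pmf)
        (use False in \<open>auto simp: set_pmf_sample[OF assms] indicator_def\<close>)
    then show ?thesis using False by simp
  next
    case True
    \<comment> \<open>Double counting of pairs (subset, member), stated without division. For
      \<open>m = Suc l\<close>, deleting \<open>x\<close> matches the \<open>m\<close>-subsets
      containing \<open>x\<close> with the \<open>l\<close>-subsets of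
      \<open>A - {x}\<close>.\<close>
    have "real (card {I \<in> ?S. x \<in> I}) * real (card A) = real m * real (card ?S)"
    proof (cases m)
      case 0
      then have "{I \<in> ?S. x \<in> I} = {}"
        using assms by (auto dest: finite_subset)
      then have "card {I \<in> ?S. x \<in> I} = 0" by (simp only: card.empty)
      then show ?thesis using 0 by (simp only: of_nat_0 mult_zero_left)
    next
      case (Suc l)
      have "bij_betw (insert x) {J. J \<subseteq> A - {x} \<and> card J = l} {I \<in> ?S. x \<in> I}"
      proof (rule bij_betw_byWitness[where f' = "\<lambda>I. I - {x}"])
        show "insert x ` {J. J \<subseteq> A - {x} \<and> card J = l} \<subseteq> {I \<in> ?S. x \<in> I}"
          using True Suc assms(1) finite_subset[of _ "A - {x}"] by (auto simp: card_insert_if)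
        show "(\<lambda>I. I - {x}) ` {I \<in> ?S. x \<in> I} \<subseteq> {J. J \<subseteq> A - {x} \<and> card J = l}"
          using Suc by auto
      qed auto
      then have "card {I \<in> ?S. x \<in> I} = (card A - 1) choose l"
        using n_subsets[of "A - {x}" l] assms(1) True by (simp add: bij_betw_same_card[symmetric])
      moreover have "card ?S = card A choose m"
        using n_subsets assms(1) by blast
      moreover have "card A * ((card A - 1) choose l) = m * (card A choose m)"
        using Suc_times_binomial_eq[of "card A - 1" l] Suc True assms(1)
        by (metis Suc_pred' card_gt_0_iff empty_iff mult.commute)
      ultimately show ?thesis
        by (metis mult.commute of_nat_mult)
    qed
    moreover have "measure_pmf.expectation (sample A m) (\<lambda>I. indicat_real I x)
        = real (card {I \<in> ?S. x \<in> I}) / real (card ?S)"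
      using fin by (simp add: S integral_pmf_of_set[OF ne fin] indicator_def sum.If_cases Int_def)
    moreover have "card A > 0" "card ?S > 0"
      using True assms(1) fin ne by (auto simp: card_gt_0_iff)
    ultimately show ?thesis using True by (simp add: frac_eq_eq)
  qed
  then show ?thesis
    by (simp add: int)
qed

subsection \<open>Latent samples and inclusion weights\<close>

text \<open>The ambient set \<open>U\<close> is carried along so that disjointness of batches passes
  to the arguments of a union. As \<open>\<pi>\<close> is finite, cardinality 0 really means that it
  is empty.\<close>

definition latent_on :: "'a set \<Rightarrow> 'a latent \<Rightarrow> bool" where
  "latent_on U = (\<lambda>(A, \<pi>, C). A \<union> \<pi> \<subseteq> U \<and> finite A \<and> finite \<pi> \<and> A \<inter> \<pi> = {} \<and> 0 \<le> C
     \<and> int (card A) = \<lfloor>C\<rfloor> \<and> card \<pi> = (if C \<in> \<int> then 0 else 1))"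

text \<open>The weight \<open>f\<close> of the partial item is a separate parameter because the
  pairs built inside \<open>downsample\<close> are not yet attached to a sample weight; there
  \<open>f\<close> is the fractional part of the target weight.\<close>

definition incl :: "'a \<Rightarrow> real \<Rightarrow> 'a set \<times> 'a set \<Rightarrow> real" where
  "incl x f = (\<lambda>(A, \<pi>). indicat_real A x + f * indicat_real \<pi> x)"

definition latent_incl :: "'a \<Rightarrow> 'a latent \<Rightarrow> real" where
  "latent_incl x = (\<lambda>(A, \<pi>, C). incl x (frac C) (A, \<pi>))"

lemma incl_pair: "incl x f (A, \<pi>) = indicat_real A x + f * indicat_real \<pi> x"
  by (simp add: incl_def)

lemma latent_incl_triple: "latent_incl x (A, \<pi>, C) = incl x (frac C) (A, \<pi>)"
  by (simp add: latent_incl_def)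

lemma incl_bounds:
  assumes "0 \<le> f" "f < 1"
  shows "0 \<le> incl x f P" "incl x f P \<le> 2"
  using assms by (auto simp: incl_def indicator_def split: prod.splits)

lemma latent_incl_bounds: "0 \<le> latent_incl x L" "latent_incl x L \<le> 2"
  using incl_bounds[of "frac (snd (snd L))" x "(fst L, fst (snd L))"]
  by (auto simp: latent_incl_def frac_lt_1 split: prod.splits)

lemma expectation_bind_incl:
  assumes "0 \<le> f" "f < 1"
  shows "measure_pmf.expectation (bind_pmf p q) (incl x f) =
    measure_pmf.expectation p (\<lambda>y. measure_pmf.expectation (q y) (incl x f))"
  by (rule expectation_bind_pmf) (use incl_bounds[OF assms] in auto)

lemma expectation_bind_latent_incl:
  "measure_pmf.expectation (bind_pmf p q) (latent_incl x) =
    measure_pmf.expectation p (\<lambda>y. measure_pmf.expectation (q y) (latent_incl x))"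
  by (rule expectation_bind_pmf) (use latent_incl_bounds in auto)

subsection \<open>Downsampling\<close>

lemma set_pmf_swap1:
  assumes "finite A" "A \<noteq> {}"
  shows "set_pmf (swap1 A \<pi>) = (\<lambda>a. (A - {a} \<union> \<pi>, {a})) ` A"
proof -
  have "1 \<le> card A" using assms by (simp add: Suc_le_eq card_gt_0_iff)
  then show ?thesis
    by (force simp: swap1_def set_pmf_sample[OF assms(1)] card_1_singleton_iff)
qed

lemma set_pmf_move1:
  assumes "finite A" "A \<noteq> {}"
  shows "set_pmf (move1 A \<pi>) = (\<lambda>a. (A - {a}, {a})) ` A"
proof -
  have "1 \<le> card A" using assms by (simp add: Suc_le_eq card_gt_0_iff)
  then show ?thesis
    by (force simp: move1_def set_pmf_sample[OF assms(1)] card_1_singleton_iff)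
qed

text \<open>A full item keeps weight 1 unless it is the one drawn, which has probability
  \<open>1 / card A\<close> and lowers its weight to \<open>f\<close>. The old partial item is
  lost.\<close>

lemma expectation_move1:
  assumes "finite A" "A \<noteq> {}" "0 \<le> f" "f < 1"
  shows "measure_pmf.expectation (move1 A \<pi>) (incl x f)
    = (1 - (1 - f) / card A) * indicat_real A x"
proof -
  have c: "1 \<le> card A" using assms by (simp add: Suc_le_eq card_gt_0_iff)
  have "measure_pmf.expectation (move1 A \<pi>) (incl x f) =
     measure_pmf.expectation (sample A 1) (\<lambda>I. incl x f (A - I, I))"
    unfolding move1_def by (subst expectation_bind_incl) (use assms in auto)
  also have "\<dots> = measure_pmf.expectation (sample A 1)
      (\<lambda>I. (f - 1) * indicat_real I x + indicat_real A x)"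
    by (rule expectation_cong_pmf)
      (auto simp: set_pmf_sample[OF assms(1) c] incl_pair indicator_def simp del: One_nat_def)
  also have "\<dots> = (1 - (1 - f) / card A) * indicat_real A x"
    unfolding expectation_sample[OF assms(1) c] using c by (simp add: field_simps)
  finally show ?thesis .
qed

text \<open>Full items fare as under \<open>move1\<close>, but the old partial item is promoted to
  weight 1.\<close>

lemma expectation_swap1:
  assumes "finite A" "A \<noteq> {}" "A \<inter> \<pi> = {}" "0 \<le> f" "f < 1"
  shows "measure_pmf.expectation (swap1 A \<pi>) (incl x f)
    = (1 - (1 - f) / card A) * indicat_real A x + indicat_real \<pi> x"
proof -
  have c: "1 \<le> card A" using assms by (simp add: Suc_le_eq card_gt_0_iff)
  have "measure_pmf.expectation (swap1 A \<pi>) (incl x f) =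
     measure_pmf.expectation (sample A 1) (\<lambda>I. incl x f (A - I \<union> \<pi>, I))"
    unfolding swap1_def by (subst expectation_bind_incl) (use assms in auto)
  also have "\<dots> = measure_pmf.expectation (sample A 1)
      (\<lambda>I. (f - 1) * indicat_real I x + (indicat_real A x + indicat_real \<pi> x))"
    by (rule expectation_cong_pmf)
      (use assms(3) in \<open>auto simp: set_pmf_sample[OF assms(1) c] incl_pair indicator_def
        simp del: One_nat_def\<close>)
  also have "\<dots> = (1 - (1 - f) / card A) * indicat_real A x + indicat_real \<pi> x"
    unfolding expectation_sample[OF assms(1) c] using c by (simp add: field_simps)
  finally show ?thesis .
qed


text \<open>The inequalities are strict: a branch of probability zero is outside the support. This
  is how branches that would use a missing partial item are excluded later.\<close>

lemma uniform_le_support: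
  "True \<in> set_pmf (uniform_le t) \<longleftrightarrow> 0 < t"
  "False \<in> set_pmf (uniform_le t) \<longleftrightarrow> t < 1"
  by (auto simp: uniform_le_def set_pmf_iff bernoulli_pmf.rep_eq)

lemma expectation_uniform_le:
  assumes "0 \<le> p" "p \<le> 1"
  shows "measure_pmf.expectation (uniform_le p) g = p * g True + (1 - p) * (g False :: real)"
  using assms by (simp add: uniform_le_def mult.commute)

text \<open>The random part of \<open>downsample\<close>, before the partial item is discarded at
  integer target weight.\<close>

definition downsample_items ::
  "'a set \<Rightarrow> 'a set \<Rightarrow> real \<Rightarrow> real \<Rightarrow> ('a set \<times> 'a set) pmf" where
  "downsample_items A \<pi> C \<theta> =
     (if \<lfloor>\<theta> * C\<rfloor> = 0 then do {
        u \<leftarrow> uniform_le (frac C / C);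
        (A', \<pi>') \<leftarrow> (if \<not> u then swap1 A \<pi> else return_pmf (A, \<pi>));
        return_pmf ({}, \<pi>')
      }
      else if \<lfloor>\<theta> * C\<rfloor> = \<lfloor>C\<rfloor> then do {
        u \<leftarrow> uniform_le ((1 - \<theta> * frac C) / (1 - frac (\<theta> * C)));
        if \<not> u then swap1 A \<pi> else return_pmf (A, \<pi>)
      }
      else do {
        u \<leftarrow> uniform_le (\<theta> * frac C);
        if u then do {
          A' \<leftarrow> sample A (nat \<lfloor>\<theta> * C\<rfloor>);
          swap1 A' \<pi>
        }
        else do {
          A' \<leftarrow> sample A (nat \<lfloor>\<theta> * C\<rfloor> + 1);
          move1 A' \<pi>
        }
      })"

lemma downsample_eq:
  assumes "\<theta> \<noteq> 1" "C \<noteq> 0"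
  shows "downsample (A, \<pi>, C) \<theta> =
    downsample_items A \<pi> C \<theta> \<bind>
      (\<lambda>(A', \<pi>'). return_pmf (A', if \<theta> * C \<in> \<int> then {} else \<pi>', \<theta> * C))"
  using assms by (simp add: downsample_def downsample_items_def Let_def)

text \<open>An item of \<open>A\<close> survives the sampling with probability
  \<open>m / card A\<close> and then has mean weight \<open>1 - (1 - f) / m\<close>; the product is
  \<open>(m - 1 + f) / card A\<close>.\<close>

lemma expectation_sample_bind_swap1:
  assumes "finite A" "0 < m" "m \<le> card A" "A \<inter> \<pi> = {}" "0 \<le> f" "f < 1"
  shows "measure_pmf.expectation (sample A m \<bind> (\<lambda>A'. swap1 A' \<pi>)) (incl x f)
    = (real m - 1 + f) / card A * indicat_real A x + indicat_real \<pi> x"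
proof -
  have "measure_pmf.expectation (sample A m \<bind> (\<lambda>A'. swap1 A' \<pi>)) (incl x f) =
     measure_pmf.expectation (sample A m)
       (\<lambda>I. (1 - (1 - f) / m) * indicat_real I x + indicat_real \<pi> x)"
    unfolding expectation_bind_incl[OF assms(5,6)]
  proof (rule expectation_cong_pmf)
    fix I assume "I \<in> set_pmf (sample A m)"
    then have I: "I \<subseteq> A" "card I = m"
      by (auto simp: set_pmf_sample[OF assms(1,3)])
    show "measure_pmf.expectation (swap1 I \<pi>) (incl x f) =
        (1 - (1 - f) / m) * indicat_real I x + indicat_real \<pi> x"
      using I assms finite_subset[OF I(1)] by (subst expectation_swap1) auto
  qed
  then show ?thesis
    using assms(2,3) by (simp add: expectation_sample[OF assms(1,3)]) (simp add: field_simps)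
qed

lemma expectation_sample_bind_move1:
  assumes "finite A" "0 < m" "m \<le> card A" "0 \<le> f" "f < 1"
  shows "measure_pmf.expectation (sample A m \<bind> (\<lambda>A'. move1 A' \<pi>)) (incl x f)
    = (real m - 1 + f) / card A * indicat_real A x"
proof -
  have "measure_pmf.expectation (sample A m \<bind> (\<lambda>A'. move1 A' \<pi>)) (incl x f) =
     measure_pmf.expectation (sample A m) (\<lambda>I. (1 - (1 - f) / m) * indicat_real I x + 0)"
    unfolding expectation_bind_incl[OF assms(4,5)]
  proof (rule expectation_cong_pmf)
    fix I assume "I \<in> set_pmf (sample A m)"
    then have I: "I \<subseteq> A" "card I = m"
      by (auto simp: set_pmf_sample[OF assms(1,3)])
    show "measure_pmf.expectation (move1 I \<pi>) (incl x f) =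
        (1 - (1 - f) / m) * indicat_real I x + 0"
      using I assms finite_subset[OF I(1)] by (subst expectation_move1) auto
  qed
  then show ?thesis
    using assms(2,3) by (simp only: expectation_sample[OF assms(1,3)]) (simp add: field_simps)
qed

section \<open>Downsampling a positive weight by a factor strictly between 0 and 1\<close>

context
  fixes U A \<pi> :: "'a set" and C \<theta> :: real
  assumes latent: "latent_on U (A, \<pi>, C)" and C: "0 < C" and \<theta>: "0 < \<theta>" "\<theta> < 1"
begin

private lemma fin: "finite A" "finite \<pi>" and disj: "A \<inter> \<pi> = {}"
  and cardA: "int (card A) = \<lfloor>C\<rfloor>" and card\<pi>: "card \<pi> = (if C \<in> \<int> then 0 else 1)"
  using latent by (auto simp: latent_on_def)

private lemma C_eq: "C = real (card A) + frac C"
  unfolding frac_def cardA[symmetric] by simp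

private lemma scaled_le: "\<theta> * C < C" "\<lfloor>\<theta> * C\<rfloor> \<le> \<lfloor>C\<rfloor>" "0 < \<theta> * C"
  using C \<theta> by (auto intro!: floor_mono)

private lemma small_threshold: "0 \<le> frac C / C" "frac C / C \<le> 1"
  using C_eq C by (auto simp: divide_le_eq_1)

private lemma large_threshold: "0 \<le> \<theta> * frac C" "\<theta> * frac C < 1"
proof -
  show "0 \<le> \<theta> * frac C" using \<theta> by simp
  have "\<theta> * frac C \<le> 1 * frac C" using \<theta> by (intro mult_right_mono) auto
  then show "\<theta> * frac C < 1" using frac_lt_1[of C] by simp
qed

text \<open>If the number of full items does not change, the whole loss of weight is taken from the
  fractional part, hence \<open>frac (\<theta> * C) \<le> \<theta> * frac C\<close> and the
  threshold is at most 1. An integer \<open>C\<close> has no fractional part to give up, so a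
  partial item exists.\<close>

private lemma mid_threshold:
  assumes "\<lfloor>\<theta> * C\<rfloor> = \<lfloor>C\<rfloor>"
  shows "frac (\<theta> * C) = \<theta> * frac C - (1 - \<theta>) * card A"
    "0 < (1 - \<theta> * frac C) / (1 - frac (\<theta> * C))" "(1 - \<theta> * frac C) / (1 - frac (\<theta> * C)) \<le> 1"
    "C \<notin> \<int>"
proof -
  have "\<theta> * C = card A + frac (\<theta> * C)"
    unfolding frac_def assms cardA[symmetric] by simp
  moreover have "\<theta> * C = \<theta> * card A + \<theta> * frac C"
    by (subst C_eq) (simp add: distrib_left)
  ultimately show eq: "frac (\<theta> * C) = \<theta> * frac C - (1 - \<theta>) * card A"
    by (simp add: algebra_simps)
  have "0 \<le> (1 - \<theta>) * card A" using \<theta> by simp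
  then have "frac (\<theta> * C) \<le> \<theta> * frac C" using eq by linarith
  then show "0 < (1 - \<theta> * frac C) / (1 - frac (\<theta> * C))"
    "(1 - \<theta> * frac C) / (1 - frac (\<theta> * C)) \<le> 1"
    using frac_lt_1[of "\<theta> * C"] large_threshold(2) by (auto simp: divide_le_eq_1)
  show "C \<notin> \<int>"
  proof
    assume "C \<in> \<int>"
    then have "C = of_int \<lfloor>C\<rfloor>" by (metis Ints_cases floor_of_int)
    also have "\<dots> \<le> \<theta> * C" using assms by linarith
    finally show False using scaled_le(1) by simp
  qed
qed

text \<open>In each regime the threshold is tuned so that the coefficients of the indicators of
  \<open>A\<close> and \<open>\<pi>\<close> become \<open>\<theta>\<close> and
  \<open>\<theta> * frac C\<close>.\<close>

lemma expectation_downsample_items: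
  "measure_pmf.expectation (downsample_items A \<pi> C \<theta>) (incl x (frac (\<theta> * C)))
    = \<theta> * incl x (frac C) (A, \<pi>)"
proof -
  define C' where "C' = \<theta> * C"
  define f' where "f' = frac C'"
  have f': "0 \<le> f'" "f' < 1" by (auto simp: f'_def frac_lt_1)
  note bind = expectation_bind_incl[OF f']
  consider (small) "\<lfloor>C'\<rfloor> = 0" | (mid) "\<lfloor>C'\<rfloor> \<noteq> 0" "\<lfloor>C'\<rfloor> = \<lfloor>C\<rfloor>"
    | (large) "\<lfloor>C'\<rfloor> \<noteq> 0" "\<lfloor>C'\<rfloor> \<noteq> \<lfloor>C\<rfloor>"
    by blast
  then have "measure_pmf.expectation (downsample_items A \<pi> C \<theta>) (incl x f')
    = \<theta> * incl x (frac C) (A, \<pi>)"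
  proof cases
    case small
    \<comment> \<open>No full item remains, so the partial item carries the whole target
      weight.\<close>
    have f'_eq: "f' = C'" using small by (simp add: f'_def frac_def)
    let ?p = "frac C / C"
    have inner: "measure_pmf.expectation (swap1 A \<pi> \<bind> (\<lambda>(A', \<pi>'). return_pmf ({}, \<pi>'))) (incl x f')
        = f' * (1 / card A) * indicat_real A x" if A: "A \<noteq> {}"
    proof -
      have c: "1 \<le> card A" using A fin by (simp add: Suc_le_eq card_gt_0_iff)
      have eq: "swap1 A \<pi> \<bind> (\<lambda>(A', \<pi>'). return_pmf ({}, \<pi>')) = sample A 1 \<bind> (\<lambda>I. return_pmf ({}, I))"
        by (simp add: swap1_def bind_assoc_pmf bind_return_pmf)
      show ?thesis
        using expectation_sample[OF fin(1) c, of f' x 0]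
        unfolding eq bind by (simp add: incl_pair)
    qed
    have "measure_pmf.expectation (downsample_items A \<pi> C \<theta>) (incl x f') =
      ?p * (f' * indicat_real \<pi> x) + (1 - ?p) *
        measure_pmf.expectation (swap1 A \<pi> \<bind> (\<lambda>(A', \<pi>'). return_pmf ({}, \<pi>'))) (incl x f')"
      unfolding downsample_items_def C'_def[symmetric] bind
        expectation_uniform_le[OF small_threshold]
      using small by (simp add: bind expectation_uniform_le[OF small_threshold] bind_return_pmf incl_pair)
    also have "\<dots> = f' / C * (frac C * indicat_real \<pi> x + indicat_real A x)"
    \<comment> \<open>Without full items the threshold is 1 and the swap term has coefficient 0, so
      its value is irrelevant.\<close>
    proof (cases "A = {}")
      case True
      then have "C = frac C" using C_eq by simp
      then have "?p = 1" using C by simp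
      then show ?thesis using True C by (simp add: \<open>C = frac C\<close>[symmetric])
    next
      case False
      then have k: "real (card A) > 0" using fin by (simp add: card_gt_0_iff)
      have e: "1 - ?p = card A / C" using C_eq C by (simp add: field_simps)
      show ?thesis unfolding e inner[OF False] using C k by (simp add: field_simps)
    qed
    finally show ?thesis using C by (simp add: f'_eq C'_def incl_pair)
  next
    case mid
    have f'_eq: "f' = \<theta> * frac C - (1 - \<theta>) * card A"
      using mid_threshold(1) mid(2) by (simp add: f'_def C'_def)
    have A: "A \<noteq> {}" using mid cardA by auto
    then have k: "real (card A) > 0" using fin by (simp add: card_gt_0_iff)
    define p where "p = (1 - \<theta> * frac C) / (1 - f')"
    have p: "0 \<le> p" "p \<le> 1"
      using mid_threshold(2,3) mid(2) by (simp_all add: p_def f'_def C'_def)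
    have pf: "p * (1 - f') = 1 - \<theta> * frac C" using f' by (simp add: p_def)
    \<comment> \<open>A swap happens with probability \<open>1 - p\<close> and costs the drawn item
      \<open>1 - f'\<close>; spread over \<open>card A\<close> items, each loses exactly
      \<open>1 - \<theta>\<close>.\<close>
    have qf: "(1 - p) * (1 - f') = (1 - \<theta>) * card A"
      using pf f'_eq by (simp add: left_diff_distrib)
    have "measure_pmf.expectation (downsample_items A \<pi> C \<theta>) (incl x f') =
      p * incl x f' (A, \<pi>)
      + (1 - p) * ((1 - (1 - f') / card A) * indicat_real A x + indicat_real \<pi> x)"
      unfolding downsample_items_def C'_def[symmetric] f'_def[symmetric] p_def[symmetric]
      using mid by (simp add: bind expectation_uniform_le[OF p]
          expectation_swap1[OF fin(1) A disj f'])
    also have "\<dots> = (1 - (1 - p) * (1 - f') / card A) * indicat_real A x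
        + (1 - p * (1 - f')) * indicat_real \<pi> x"
      by (simp add: incl_pair algebra_simps add_divide_distrib diff_divide_distrib)
    finally show ?thesis using k unfolding pf qf by (simp add: incl_pair distrib_left)
  next
    case large
    have pos: "0 < \<lfloor>C'\<rfloor>" "\<lfloor>C'\<rfloor> < \<lfloor>C\<rfloor>"
      using large scaled_le unfolding C'_def by (auto simp: order_less_le)
    define m where "m = nat \<lfloor>C'\<rfloor>"
    have m: "0 < m" "m \<le> card A" "0 < m + 1" "m + 1 \<le> card A" "real m = of_int \<lfloor>C'\<rfloor>"
    proof -
      have "int m = \<lfloor>C'\<rfloor>" using pos by (simp add: m_def)
      then show "0 < m" "m \<le> card A" "m + 1 \<le> card A" "real m = of_int \<lfloor>C'\<rfloor>"
        using pos cardA by linarith+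
    qed simp
    have mf: "real m + f' = \<theta> * card A + \<theta> * frac C"
    proof -
      have "real m + f' = C'" using m(5) by (simp add: f'_def frac_def)
      also have "\<dots> = \<theta> * card A + \<theta> * frac C"
        unfolding C'_def by (subst C_eq) (simp add: distrib_left)
      finally show ?thesis .
    qed
    have k: "real (card A) > 0" using m by simp
    let ?p = "\<theta> * frac C"
    have "measure_pmf.expectation (downsample_items A \<pi> C \<theta>) (incl x f') =
      ?p * ((real m - 1 + f') / card A * indicat_real A x + indicat_real \<pi> x)
      + (1 - ?p) * ((real (m + 1) - 1 + f') / card A * indicat_real A x)"
      unfolding downsample_items_def C'_def[symmetric] f'_def[symmetric] m_def[symmetric] bind
        expectation_uniform_le[OF large_threshold(1) less_imp_le[OF large_threshold(2)]]
      using large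
      by (simp add: bind expectation_uniform_le[OF large_threshold(1) less_imp_le[OF large_threshold(2)]]
         expectation_sample_bind_swap1[OF fin(1) m(1,2) disj f', unfolded bind]
         expectation_sample_bind_move1[OF fin(1) m(3,4) f', unfolded bind, simplified])
    \<comment> \<open>The two branches differ by one in the mean total weight left to
      \<open>A\<close>, namely \<open>m - 1 + f'\<close> against \<open>m + f'\<close>, so averaging
      subtracts the probability \<open>?p\<close>. What remains is \<open>\<theta> * card A\<close>
      by \<open>mf\<close>.\<close>
    also have "\<dots> = ((real m + f') - ?p) / card A * indicat_real A x + ?p * indicat_real \<pi> x"
      by (simp add: algebra_simps add_divide_distrib diff_divide_distrib)
    also have "\<dots> = \<theta> * incl x (frac C) (A, \<pi>)"
      using k unfolding mf by (simp add: incl_pair algebra_simps)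
    finally show ?thesis .
  qed
  then show ?thesis by (simp add: f'_def C'_def)
qed

text \<open>Only branches of positive probability count: keeping or promoting the partial item then
  forces \<open>\<pi>\<close> to be nonempty, and every swap draws from a nonempty set.\<close>

lemma set_pmf_downsample_items:
  assumes "(A', \<pi>') \<in> set_pmf (downsample_items A \<pi> C \<theta>)"
  shows "A' \<union> \<pi>' \<subseteq> A \<union> \<pi> \<and> A' \<inter> \<pi>' = {} \<and> int (card A') = \<lfloor>\<theta> * C\<rfloor> \<and>
    (\<theta> * C \<notin> \<int> \<longrightarrow> card \<pi>' = 1)"
proof -
  define C' where "C' = \<theta> * C"
  \<comment> \<open>Shared by all regimes: \<open>J\<close> is \<open>A\<close> itself or the subset
    sampled from it.\<close>
  have swap: "P \<union> Q \<subseteq> A \<union> \<pi> \<and> P \<inter> Q = {} \<and> card P = card J - 1 + card \<pi> \<and> card Q = 1"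
    if PQ: "(P, Q) \<in> set_pmf (swap1 J \<pi>)" and JA: "J \<subseteq> A" and ne: "J \<noteq> {}" for P Q J
  proof -
    have J: "finite J" "J \<inter> \<pi> = {}" using JA disj fin by (auto dest: finite_subset)
    obtain a where a: "a \<in> J" "P = J - {a} \<union> \<pi>" "Q = {a}"
      using PQ by (auto simp: set_pmf_swap1[OF J(1) ne])
    have "card P = card (J - {a}) + card \<pi>"
      unfolding a(2) by (rule card_Un_disjoint) (use J fin in auto)
    then show ?thesis using a J JA disj by auto
  qed
  consider (small) "\<lfloor>C'\<rfloor> = 0" | (mid) "\<lfloor>C'\<rfloor> \<noteq> 0" "\<lfloor>C'\<rfloor> = \<lfloor>C\<rfloor>"
    | (large) "\<lfloor>C'\<rfloor> \<noteq> 0" "\<lfloor>C'\<rfloor> \<noteq> \<lfloor>C\<rfloor>"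
    by blast
  then show ?thesis
  proof cases
    case small
    have "A' = {} \<and> card \<pi>' = 1 \<and> \<pi>' \<subseteq> A \<union> \<pi>"
    proof -
      obtain u P where u: "u \<in> set_pmf (uniform_le (frac C / C))" "A' = {}"
        "(P, \<pi>') \<in> set_pmf (if \<not> u then swap1 A \<pi> else return_pmf (A, \<pi>))"
        using assms small by (auto simp: downsample_items_def C'_def[symmetric])
      show ?thesis
      proof (cases u)
        case True
        then have "C \<notin> \<int>" using u(1) C by (simp add: uniform_le_support zero_less_divide_iff)
        then show ?thesis using True u card\<pi> by auto
      next
        case False
        then have "frac C / C < 1" using u(1) by (simp add: uniform_le_support)
        then have "A \<noteq> {}" using C C_eq by (auto simp: divide_less_eq)
        then show ?thesis using swap[of P \<pi>' A] u False by auto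
      qed
    qed
    then show ?thesis using small by (auto simp: C'_def)
  next
    case mid
    then have A: "A \<noteq> {}" using cardA by auto
    have \<pi>1: "card \<pi> = 1" using mid mid_threshold(4) card\<pi> by (simp add: C'_def)
    have "(A', \<pi>') \<in> set_pmf (swap1 A \<pi>) \<or> (A', \<pi>') = (A, \<pi>)"
      using assms mid by (auto simp: downsample_items_def C'_def[symmetric] split: if_splits)
    then show ?thesis
    proof
      assume "(A', \<pi>') \<in> set_pmf (swap1 A \<pi>)"
      from swap[OF this _ A] show ?thesis
        using \<pi>1 A fin cardA mid(2) by (auto simp: C'_def card_gt_0_iff Suc_le_eq)
    next
      assume "(A', \<pi>') = (A, \<pi>)"
      then show ?thesis using \<pi>1 cardA mid(2) disj by (auto simp: C'_def)
    qed
  next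
    case large
    have pos: "0 < \<lfloor>C'\<rfloor>" "\<lfloor>C'\<rfloor> < \<lfloor>C\<rfloor>"
      using large scaled_le unfolding C'_def by (auto simp: order_less_le)
    define m where "m = nat \<lfloor>C'\<rfloor>"
    have m: "0 < m" "m \<le> card A" "0 < m + 1" "m + 1 \<le> card A" "int m = \<lfloor>C'\<rfloor>"
    proof -
      show "int m = \<lfloor>C'\<rfloor>" using pos by (simp add: m_def)
      then show "0 < m" "m \<le> card A" "m + 1 \<le> card A" using pos cardA by linarith+
    qed simp
    obtain u where u: "u \<in> set_pmf (uniform_le (\<theta> * frac C))"
      "(A', \<pi>') \<in> set_pmf (if u then sample A m \<bind> (\<lambda>A'. swap1 A' \<pi>)
         else sample A (m + 1) \<bind> (\<lambda>A'. move1 A' \<pi>))"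
      using assms large unfolding downsample_items_def C'_def[symmetric] m_def[symmetric] by auto
    show ?thesis
    proof (cases u)
      case True
      then have "card \<pi> = 1"
        using u(1) \<theta> card\<pi> by (auto simp: uniform_le_support zero_less_mult_iff)
      moreover obtain J where J: "J \<subseteq> A" "card J = m" "(A', \<pi>') \<in> set_pmf (swap1 J \<pi>)"
        using u(2) True by (auto simp: set_pmf_sample[OF fin(1) m(2)])
      moreover have "J \<noteq> {}" using J(2) m(1) by auto
      ultimately show ?thesis
        using swap[of A' \<pi>' J] m(1) unfolding m(5)[unfolded C'_def, symmetric] by simp
    next
      case False
      then obtain J where J: "J \<in> set_pmf (sample A (m + 1))" "(A', \<pi>') \<in> set_pmf (move1 J \<pi>)"
        using u(2) by (auto simp del: One_nat_def add_Suc_right)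
      then have J': "J \<subseteq> A" "card J = m + 1"
        unfolding set_pmf_sample[OF fin(1) m(4)] by blast+
      have fJ: "finite J" "J \<noteq> {}" using J' finite_subset[OF J'(1) fin(1)] by auto
      obtain a where a: "a \<in> J" "A' = J - {a}" "\<pi>' = {a}"
        using J(2) unfolding set_pmf_move1[OF fJ] by blast
      have "int (card A') = \<lfloor>\<theta> * C\<rfloor>"
        using a fJ J'(2) m(5) by (simp add: C'_def)
      moreover have "A' \<union> \<pi>' \<subseteq> A \<union> \<pi>" "A' \<inter> \<pi>' = {}" "card \<pi>' = 1"
        using a J'(1) by auto
      ultimately show ?thesis by blast
    qed
  qed
qed

end

lemma latent_on_subitems:
  assumes "latent_on U (A, \<pi>, C)" "A' \<union> \<pi>' \<subseteq> A \<union> \<pi>" "A' \<inter> \<pi>' = {}" "0 \<le> C'"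
    "int (card A') = \<lfloor>C'\<rfloor>" "card \<pi>' = (if C' \<in> \<int> then 0 else 1)"
  shows "latent_on U (A', \<pi>', C')"
proof -
  have "finite (A \<union> \<pi>)" "A \<union> \<pi> \<subseteq> U" using assms(1) by (auto simp: latent_on_def)
  then show ?thesis using assms by (auto simp: latent_on_def dest: finite_subset)
qed

lemma latent_on_zero:
  assumes "latent_on U (A, \<pi>, 0)"
  shows "A = {}" "\<pi> = {}"
  using assms by (auto simp: latent_on_def)

lemma set_pmf_downsample:
  assumes "latent_on U L" "0 < \<theta>" "\<theta> \<le> 1" "L' \<in> set_pmf (downsample L \<theta>)"
  shows "latent_on U L'" "snd (snd L') = \<theta> * snd (snd L)"
proof -
  obtain A \<pi> C where L: "L = (A, \<pi>, C)" by (metis prod_cases3)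
  have "latent_on U L' \<and> snd (snd L') = \<theta> * snd (snd L)"
  proof (cases "\<theta> = 1 \<or> C = 0")
    case True
    \<comment> \<open>A latent sample of weight 0 has no items, so the clause of
      \<open>downsample\<close> for the empty latent sample applies.\<close>
    then have "downsample L \<theta> = return_pmf L"
      using assms(1) latent_on_zero[of U A \<pi>] by (auto simp: L downsample_def)
    then show ?thesis using True assms by (auto simp: L)
  next
    case False
    then have C: "0 < C" and \<theta>: "\<theta> < 1" using assms by (auto simp: L latent_on_def)
    obtain A' \<pi>' where *: "(A', \<pi>') \<in> set_pmf (downsample_items A \<pi> C \<theta>)"
      "L' = (A', if \<theta> * C \<in> \<int> then {} else \<pi>', \<theta> * C)"
      using assms(4) False by (auto simp: L downsample_eq)
    have "latent_on U L'" unfolding *(2)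
      by (rule latent_on_subitems[OF assms(1)[unfolded L]])
        (use set_pmf_downsample_items[OF assms(1)[unfolded L] C assms(2) \<theta> *(1)] C assms(2) in auto)
    then show ?thesis using * by (simp add: L)
  qed
  then show "latent_on U L'" "snd (snd L') = \<theta> * snd (snd L)" by auto
qed

lemma expectation_downsample:
  assumes "latent_on U L" "0 < \<theta>" "\<theta> \<le> 1"
  shows "measure_pmf.expectation (downsample L \<theta>) (latent_incl x) = \<theta> * latent_incl x L"
proof -
  obtain A \<pi> C where L: "L = (A, \<pi>, C)" by (metis prod_cases3)
  show ?thesis
  proof (cases "\<theta> = 1 \<or> C = 0")
    case True
    then have "downsample L \<theta> = return_pmf L" "\<theta> = 1 \<or> latent_incl x L = 0"
      using assms(1) latent_on_zero[of U A \<pi>]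
      by (auto simp: L downsample_def latent_incl_triple incl_pair)
    then show ?thesis by auto
  next
    case False
    then have C: "0 < C" and \<theta>: "\<theta> < 1" using assms by (auto simp: L latent_on_def)
    \<comment> \<open>Discarding the partial item at integer weight is harmless, since its
      coefficient \<open>frac (\<theta> * C)\<close> is then 0.\<close>
    have "latent_incl x (A', if \<theta> * C \<in> \<int> then {} else \<pi>', \<theta> * C) = incl x (frac (\<theta> * C)) (A', \<pi>')"
      for A' \<pi>' using frac_eq_0_iff[of "\<theta> * C"] by (auto simp: latent_incl_triple incl_pair)
    then have "measure_pmf.expectation (downsample L \<theta>) (latent_incl x) =
        measure_pmf.expectation (downsample_items A \<pi> C \<theta>) (incl x (frac (\<theta> * C)))"
      using False
      by (simp add: L downsample_eq expectation_bind_latent_incl case_prod_unfold)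
    also have "\<dots> = \<theta> * latent_incl x L"
      using expectation_downsample_items[OF assms(1)[unfolded L] C assms(2) \<theta>]
      by (simp add: L latent_incl_triple)
    finally show ?thesis .
  qed
qed

subsection \<open>Unions\<close>

text \<open>Adding the weights carries into the integer part exactly when the fractional parts sum
  to at least 1, and exactly then a partial item is promoted to a full one.\<close>

lemma set_pmf_union_latent:
  assumes L1: "latent_on U1 L1" and L2: "latent_on U2 L2" and disj: "U1 \<inter> U2 = {}"
    and L: "L \<in> set_pmf (union_latent L1 L2)"
  shows "latent_on (U1 \<union> U2) L" "snd (snd L) = snd (snd L1) + snd (snd L2)"
proof -
  obtain A1 \<pi>1 C1 where L1': "L1 = (A1, \<pi>1, C1)" by (metis prod_cases3)
  obtain A2 \<pi>2 C2 where L2': "L2 = (A2, \<pi>2, C2)" by (metis prod_cases3)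
  have 1: "A1 \<subseteq> U1" "\<pi>1 \<subseteq> U1" "finite A1" "finite \<pi>1" "A1 \<inter> \<pi>1 = {}" "0 \<le> C1"
      "int (card A1) = \<lfloor>C1\<rfloor>" "card \<pi>1 = (if C1 \<in> \<int> then 0 else 1)"
    using L1 by (auto simp: L1' latent_on_def)
  have 2: "A2 \<subseteq> U2" "\<pi>2 \<subseteq> U2" "finite A2" "finite \<pi>2" "A2 \<inter> \<pi>2 = {}" "0 \<le> C2"
      "int (card A2) = \<lfloor>C2\<rfloor>" "card \<pi>2 = (if C2 \<in> \<int> then 0 else 1)"
    using L2 by (auto simp: L2' latent_on_def)
  define a b where ab: "a = frac C1" "b = frac C2"
  have int_iff: "C1 \<in> \<int> \<longleftrightarrow> a = 0" "C2 \<in> \<int> \<longleftrightarrow> b = 0" "C1 + C2 \<in> \<int> \<longleftrightarrow> frac (C1 + C2) = 0"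
    by (simp_all add: ab)
  have range: "0 \<le> a" "a < 1" "0 \<le> b" "b < 1" by (simp_all add: ab frac_lt_1)
  have fl: "\<lfloor>C1 + C2\<rfloor> = (if a + b < 1 then \<lfloor>C1\<rfloor> + \<lfloor>C2\<rfloor> else \<lfloor>C1\<rfloor> + \<lfloor>C2\<rfloor> + 1)"
    and fr: "frac (C1 + C2) = (if a + b < 1 then a + b else a + b - 1)"
    by (simp_all add: ab floor_add frac_add)
  have D: "A1 \<inter> \<pi>1 = {}" "A1 \<inter> \<pi>2 = {}" "A2 \<inter> \<pi>1 = {}" "A2 \<inter> \<pi>2 = {}"
    "\<pi>1 \<inter> \<pi>2 = {}" "\<pi>2 \<inter> \<pi>1 = {}"
    and sub: "A1 \<subseteq> U1 \<union> U2" "A2 \<subseteq> U1 \<union> U2" "\<pi>1 \<subseteq> U1 \<union> U2" "\<pi>2 \<subseteq> U1 \<union> U2"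
    using 1 2 disj by blast+
  have cards: "card (A1 \<union> A2) = card A1 + card A2"
    "card (A1 \<union> A2 \<union> \<pi>1) = card A1 + card A2 + card \<pi>1"
    "card (A1 \<union> A2 \<union> \<pi>2) = card A1 + card A2 + card \<pi>2"
    using 1 2 disj by (subst card_Un_disjoint; auto simp: card_Un_disjoint)+
  note simps = latent_on_def int_iff fl fr cards Int_Un_distrib2 D sub 1(3,4,6-8) 2(3,4,6-8)
  consider (lt) "a + b < 1" | (eq) "a + b = 1" | (gt) "a + b > 1" by linarith
  then have "latent_on (U1 \<union> U2) L \<and> snd (snd L) = C1 + C2"
  proof cases
    case lt
    \<comment> \<open>A side is chosen with positive probability only if its fractional part is
      positive, so the chosen partial item exists.\<close>
    obtain \<pi> where \<pi>: "L = (A1 \<union> A2, \<pi>, C1 + C2)"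
      "\<pi> = {} \<and> a + b = 0 \<or> \<pi> = \<pi>1 \<and> a > 0 \<or> \<pi> = \<pi>2 \<and> b > 0"
    proof (cases "a = 0 \<and> b = 0")
      case True
      then show ?thesis using that L
        by (simp add: union_latent_def L1' L2' Let_def ab[symmetric])
    next
      case False
      then have s: "a + b > 0" using range by linarith
      obtain u where "u \<in> set_pmf (uniform_le (a / (a + b)))"
        "L = (A1 \<union> A2, if u then \<pi>1 else \<pi>2, C1 + C2)"
        using L lt False by (auto simp: union_latent_def L1' L2' Let_def ab[symmetric])
      then show ?thesis
        using that s by (cases u) (auto simp: uniform_le_support zero_less_divide_iff divide_less_eq)
    qed
    then show ?thesis
      using lt range by (elim disjE) (auto simp: simps)
  next
    case eq
    have "L = (A1 \<union> A2 \<union> \<pi>1, {}, C1 + C2) \<or> L = (A1 \<union> A2 \<union> \<pi>2, {}, C1 + C2)"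
      using L eq by (auto simp: union_latent_def L1' L2' Let_def ab[symmetric] split: if_splits)
    \<comment> \<open>Since \<open>a\<close> and \<open>b\<close> are both below 1, a sum of 1 makes
      both positive, so the promoted item exists; the same argument serves the case
      \<open>gt\<close>.\<close>
    then show ?thesis
      using eq range by (elim disjE) (auto simp: simps)
  next
    case gt
    have "L = (A1 \<union> A2 \<union> \<pi>2, \<pi>1, C1 + C2) \<or> L = (A1 \<union> A2 \<union> \<pi>1, \<pi>2, C1 + C2)"
      using L gt by (auto simp: union_latent_def L1' L2' Let_def ab[symmetric] split: if_splits)
    then show ?thesis
      using gt range by (elim disjE) (auto simp: simps)
  qed
  then show "latent_on (U1 \<union> U2) L" "snd (snd L) = snd (snd L1) + snd (snd L2)"
    by (simp_all add: L1' L2')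
qed

text \<open>The probabilities are chosen so that the former partial items keep mean weights
  \<open>a\<close> and \<open>b\<close>, whether they compete for one partial slot or one of them is
  promoted.\<close>

lemma expectation_union_latent:
  assumes L1: "latent_on U1 L1" and L2: "latent_on U2 L2" and disj: "U1 \<inter> U2 = {}"
  shows "measure_pmf.expectation (union_latent L1 L2) (latent_incl x) =
    latent_incl x L1 + latent_incl x L2"
proof -
  obtain A1 \<pi>1 C1 where L1': "L1 = (A1, \<pi>1, C1)" by (metis prod_cases3)
  obtain A2 \<pi>2 C2 where L2': "L2 = (A2, \<pi>2, C2)" by (metis prod_cases3)
  have 1: "A1 \<subseteq> U1" "\<pi>1 \<subseteq> U1" "A1 \<inter> \<pi>1 = {}"
    using L1 by (auto simp: L1' latent_on_def)
  have 2: "A2 \<subseteq> U2" "\<pi>2 \<subseteq> U2" "A2 \<inter> \<pi>2 = {}"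
    using L2 by (auto simp: L2' latent_on_def)
  define a b where ab: "a = frac C1" "b = frac C2"
  have range: "0 \<le> a" "a < 1" "0 \<le> b" "b < 1" by (simp_all add: ab frac_lt_1)
  have fr: "frac (C1 + C2) = (if a + b < 1 then a + b else a + b - 1)"
    by (simp_all add: ab frac_add)
  have ind: "indicat_real (A1 \<union> A2) x = indicat_real A1 x + indicat_real A2 x"
    "indicat_real (A1 \<union> A2 \<union> \<pi>1) x = indicat_real A1 x + indicat_real A2 x + indicat_real \<pi>1 x"
    "indicat_real (A1 \<union> A2 \<union> \<pi>2) x = indicat_real A1 x + indicat_real A2 x + indicat_real \<pi>2 x"
    using 1 2 disj by (auto simp: indicator_def)
  have R: "latent_incl x L1 + latent_incl x L2 =
    indicat_real A1 x + indicat_real A2 x + a * indicat_real \<pi>1 x + b * indicat_real \<pi>2 x"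
    by (simp add: latent_incl_triple incl_pair L1' L2' ab)
  consider (zero) "a = 0" "b = 0" | (lt) "a + b < 1" "a + b > 0" | (eq) "a + b = 1" | (gt) "a + b > 1"
    using range by linarith
  then show ?thesis
  proof cases
    case zero
    then show ?thesis
      unfolding R using fr
      by (simp add: union_latent_def L1' L2' Let_def ab[symmetric] latent_incl_triple incl_pair ind)
  next
    case lt
    define p where "p = a / (a + b)"
    have p: "0 \<le> p" "p \<le> 1" using range lt by (auto simp: p_def)
    have pa: "p * (a + b) = a" using lt by (simp add: p_def)
    then have pb: "(1 - p) * (a + b) = b" by (simp add: left_diff_distrib)
    have "measure_pmf.expectation (union_latent L1 L2) (latent_incl x) =
      p * (indicat_real A1 x + indicat_real A2 x + (a + b) * indicat_real \<pi>1 x) +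
      (1 - p) * (indicat_real A1 x + indicat_real A2 x + (a + b) * indicat_real \<pi>2 x)"
      using lt fr
      by (simp add: union_latent_def L1' L2' Let_def ab[symmetric] p_def[symmetric]
          expectation_bind_latent_incl expectation_uniform_le[OF p] latent_incl_triple incl_pair ind)
    also have "\<dots> = indicat_real A1 x + indicat_real A2 x
        + (p * (a + b)) * indicat_real \<pi>1 x + ((1 - p) * (a + b)) * indicat_real \<pi>2 x"
      by (simp add: algebra_simps)
    finally show ?thesis unfolding R pa pb .
  next
    case eq
    have "measure_pmf.expectation (union_latent L1 L2) (latent_incl x) =
      a * (indicat_real A1 x + indicat_real A2 x + indicat_real \<pi>1 x) +
      (1 - a) * (indicat_real A1 x + indicat_real A2 x + indicat_real \<pi>2 x)"
      using eq range
      by (simp add: union_latent_def L1' L2' Let_def ab[symmetric] expectation_bind_latent_incl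
          expectation_uniform_le latent_incl_triple incl_pair ind)
    moreover have b: "b = 1 - a" using eq by simp
    ultimately show ?thesis unfolding R b by (simp add: algebra_simps)
  next
    case gt
    define p where "p = (1 - a) / ((1 - a) + (1 - b))"
    have p: "0 \<le> p" "p \<le> 1" using range by (auto simp: p_def divide_le_eq_1)
    have pa: "p * ((1 - a) + (1 - b)) = 1 - a" using range by (simp add: p_def)
    have "measure_pmf.expectation (union_latent L1 L2) (latent_incl x) =
      p * (indicat_real A1 x + indicat_real A2 x + indicat_real \<pi>2 x
        + (a + b - 1) * indicat_real \<pi>1 x) +
      (1 - p) * (indicat_real A1 x + indicat_real A2 x + indicat_real \<pi>1 x
        + (a + b - 1) * indicat_real \<pi>2 x)"
      unfolding union_latent_def L1' L2' Let_def prod.case ab[symmetric] p_def[symmetric]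
      using gt fr
      by (simp add: expectation_bind_latent_incl expectation_uniform_le[OF p]
          latent_incl_triple incl_pair ind)
    \<comment> \<open>The item of \<open>\<pi>1\<close> is full with probability
      \<open>1 - p\<close> and otherwise has weight \<open>a + b - 1\<close>. As a demotion costs
      \<open>(1 - a) + (1 - b)\<close>, its mean weight is \<open>1 - (1 - a) = a\<close>.\<close>
    also have "\<dots> = indicat_real A1 x + indicat_real A2 x +
      (1 - p * ((1 - a) + (1 - b))) * indicat_real \<pi>1 x +
      ((a + b - 1) + p * ((1 - a) + (1 - b))) * indicat_real \<pi>2 x"
      by (simp add: algebra_simps)
    finally show ?thesis unfolding R pa by simp
  qed
qed

subsection \<open>The iteration of R-TBS\<close>

lemma total_weight_nonneg: "0 \<le> total_weight lam \<Delta> B k"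
  by (auto simp: total_weight_def decay_def intro!: sum_nonneg)

lemma decay_age_Suc: "decay lam (age \<Delta> i (Suc k)) = exp (- lam * \<Delta>) * decay lam (age \<Delta> i k)"
  by (simp add: decay_def age_def batch_time_def exp_add[symmetric] algebra_simps)

lemma decay_age_self: "decay lam (age \<Delta> k k) = 1"
  by (simp add: decay_def age_def)

lemma total_weight_Suc:
  "total_weight lam \<Delta> B (Suc k) = exp (- lam * \<Delta>) * total_weight lam \<Delta> B k + card (B (Suc k))"
  by (simp add: total_weight_def decay_age_self)
    (simp add: decay_age_Suc sum_distrib_left mult.left_commute)

lemma rho_bounds:
  assumes "n \<ge> 1"
  shows "0 < rho lam n \<Delta> B k" "rho lam n \<Delta> B k \<le> 1"
  using assms total_weight_nonneg[of lam \<Delta> B k] by (auto simp: rho_def cap_ratio_def min_def)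

text \<open>The minimum on the right is bounded below through its two arguments: the exponential
  factor is at most 1, and \<open>W' \<ge> t * W\<close> gives
  \<open>n / W' * t \<le> n / W\<close>. For \<open>W = 0\<close> the convention makes the right
  side 1.\<close>

lemma rho_Suc_le:
  assumes "lam \<ge> 0" "\<Delta> > 0"
  shows "rho lam n \<Delta> B (Suc k) * exp (- lam * \<Delta>) \<le> rho lam n \<Delta> B k"
proof -
  define t W W' where "t = exp (- lam * \<Delta>)" and "W = total_weight lam \<Delta> B k"
    and "W' = total_weight lam \<Delta> B (Suc k)"
  have t: "0 < t" "t \<le> 1" using assms by (auto simp: t_def)
  have W: "0 \<le> W" "t * W \<le> W'" by (simp_all add: W_def W'_def t_def total_weight_nonneg total_weight_Suc)
  have "cap_ratio n W' * t \<le> cap_ratio n W"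
  proof (cases "W = 0")
    case True
    have "cap_ratio n W' \<le> 1" by (simp add: cap_ratio_def)
    then have "cap_ratio n W' * t \<le> 1 * 1" using t by (intro mult_mono) auto
    then show ?thesis using True by (simp add: cap_ratio_def)
  next
    case False
    then have "0 < W" "0 < t * W" using W t by auto
    then have pos: "0 < W" "0 < t * W" "0 < W'" using W by linarith+
    have "real n / W' * t \<le> real n / (t * W) * t"
      using pos W t by (intro mult_right_mono divide_left_mono) auto
    also have "\<dots> = real n / W" using t by simp
    finally have "cap_ratio n W' * t \<le> real n / W"
      using pos t mult_right_mono[of "cap_ratio n W'" "real n / W'" t] by (simp add: cap_ratio_def)
    moreover have "cap_ratio n W' * t \<le> 1 * 1"
      using t pos by (intro mult_mono) (auto simp: cap_ratio_def)
    ultimately show ?thesis using pos by (simp add: cap_ratio_def)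
  qed
  then show ?thesis by (simp add: rho_def t_def W_def W'_def)
qed

lemma rho_decay_antimono:
  assumes "lam \<ge> 0" "\<Delta> > 0"
  shows "rho lam n \<Delta> B (Suc k) * decay lam (age \<Delta> i (Suc k)) \<le> rho lam n \<Delta> B k * decay lam (age \<Delta> i k)"
proof -
  have "rho lam n \<Delta> B (Suc k) * exp (- lam * \<Delta>) * decay lam (age \<Delta> i k)
      \<le> rho lam n \<Delta> B k * decay lam (age \<Delta> i k)"
    using rho_Suc_le[OF assms] by (rule mult_right_mono) (simp add: decay_def)
  then show ?thesis by (simp add: decay_age_Suc mult.assoc)
qed

text \<open>The factor \<open>(\<rho> / \<rho>') \<theta>\<close> of the algorithm in step \<open>k + 1\<close>.\<close>

definition rtbs_retention :: "real \<Rightarrow> nat \<Rightarrow> real \<Rightarrow> (nat \<Rightarrow> 'a set) \<Rightarrow> nat \<Rightarrow> real" where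
  "rtbs_retention lam n \<Delta> B k = rho lam n \<Delta> B (Suc k) / rho lam n \<Delta> B k * exp (- lam * \<Delta>)"

lemma rtbs_retention_bounds:
  assumes "lam \<ge> 0" "n \<ge> 1" "\<Delta> > 0"
  shows "0 < rtbs_retention lam n \<Delta> B k" "rtbs_retention lam n \<Delta> B k \<le> 1"
  using rho_bounds[OF assms(2), of lam \<Delta> B k] rho_bounds[OF assms(2), of lam \<Delta> B "Suc k"]
    rho_Suc_le[OF assms(1,3), of n B k]
  by (auto simp: rtbs_retention_def divide_le_eq_1)

lemma rtbs_step_eq:
  assumes "latent_on U L"
  shows "rtbs_step lam n \<Delta> B (Suc k) (total_weight lam \<Delta> B k, rho lam n \<Delta> B k, L) =
    downsample L (rtbs_retention lam n \<Delta> B k) \<bind> (\<lambda>L1.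
    downsample (B (Suc k), {}, real (card (B (Suc k)))) (rho lam n \<Delta> B (Suc k)) \<bind> (\<lambda>L0.
    union_latent L0 L1 \<bind> (\<lambda>L'.
    return_pmf (total_weight lam \<Delta> B (Suc k), rho lam n \<Delta> B (Suc k), L'))))"
proof -
  obtain A \<pi> C where L: "L = (A, \<pi>, C)" by (metis prod_cases3)
  have "return_pmf L = downsample L \<theta>" if "\<not> 0 < C" for \<theta>
  proof -
    have "C = 0" using that assms by (simp add: L latent_on_def)
    then show ?thesis using latent_on_zero[of U A \<pi>] assms by (simp add: L downsample_def)
  qed
  then have "(if 0 < snd (snd L) then downsample L \<theta> else return_pmf L) = downsample L \<theta>" for \<theta>
    by (simp add: L)
  moreover have "exp (- lam * \<Delta>) * total_weight lam \<Delta> B k + card (B (Suc k)) = total_weight lam \<Delta> B (Suc k)"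
    by (simp add: total_weight_Suc)
  moreover have "batch_time \<Delta> (Suc k) - batch_time \<Delta> (Suc k - 1) = \<Delta>"
    by (simp add: batch_time_def algebra_simps)
  ultimately show ?thesis
    unfolding rtbs_step_def rtbs_retention_def rho_def Let_def prod.case by simp
qed

lemma latent_on_batch: "finite A \<Longrightarrow> latent_on A (A, {}, real (card A))"
  by (simp add: latent_on_def)

lemma latent_incl_batch: "latent_incl x (A, {}, real (card A)) = indicat_real A x"
  by (simp add: latent_incl_triple incl_pair)

text \<open>Condition first on the downsampled old sample, then on the downsampled batch. Given
  both, the union adds inclusion weights, and each summand averages to its own scaling.\<close>

lemma expectation_union_downsampled:
  assumes L0: "latent_on U0 L0" "0 < \<theta>0" "\<theta>0 \<le> 1" and L1: "latent_on U1 L1" "0 < \<theta>1" "\<theta>1 \<le> 1"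
    and disj: "U0 \<inter> U1 = {}"
  shows "measure_pmf.expectation (downsample L1 \<theta>1 \<bind> (\<lambda>L1'. downsample L0 \<theta>0 \<bind> (\<lambda>L0'.
      union_latent L0' L1'))) (latent_incl x) = \<theta>0 * latent_incl x L0 + \<theta>1 * latent_incl x L1"
proof -
  have int: "integrable (measure_pmf p) (latent_incl x)" for p
    by (rule measure_pmf.integrable_const_bound[where B = 2]) (auto simp: latent_incl_bounds)
  have "measure_pmf.expectation (downsample L0 \<theta>0 \<bind> (\<lambda>L0'. union_latent L0' L1')) (latent_incl x) =
      \<theta>0 * latent_incl x L0 + latent_incl x L1'" if "L1' \<in> set_pmf (downsample L1 \<theta>1)" for L1'
  proof -
    have "measure_pmf.expectation (downsample L0 \<theta>0 \<bind> (\<lambda>L0'. union_latent L0' L1')) (latent_incl x) =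
      measure_pmf.expectation (downsample L0 \<theta>0) (\<lambda>L0'. latent_incl x L0' + latent_incl x L1')"
      unfolding expectation_bind_latent_incl
      by (rule expectation_cong_pmf, rule expectation_union_latent[OF _ _ disj])
        (use set_pmf_downsample(1)[OF L0] set_pmf_downsample(1)[OF L1] that in auto)
    then show ?thesis by (simp add: int expectation_downsample[OF L0])
  qed
  then have "measure_pmf.expectation (downsample L1 \<theta>1 \<bind> (\<lambda>L1'. downsample L0 \<theta>0 \<bind> (\<lambda>L0'.
      union_latent L0' L1'))) (latent_incl x) =
      measure_pmf.expectation (downsample L1 \<theta>1) (\<lambda>L1'. \<theta>0 * latent_incl x L0 + latent_incl x L1')"
    unfolding expectation_bind_latent_incl[of "downsample L1 \<theta>1"] by (intro expectation_cong_pmf) auto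
  then show ?thesis by (simp add: int expectation_downsample[OF L1])
qed

section \<open>The law of the loop state\<close>

context
  fixes lam \<Delta> :: real and n :: nat and B :: "nat \<Rightarrow> 'a set"
  assumes lam: "lam \<ge> 0" and n: "n \<ge> 1" and \<Delta>: "\<Delta> > 0"
    and fin: "\<forall>k\<ge>1. finite (B k)" and disj: "disjoint_family_on B {1..}"
begin

private abbreviation "seen k \<equiv> (\<Union>i\<in>{1..k}. B i)"

private lemma seen_disjoint: "B (Suc k) \<inter> seen k = {}"
proof -
  have "B (Suc k) \<inter> B i = {}" if "i \<in> {1..k}" for i
    using that by (intro disjoint_family_onD[OF disj]) auto
  then show ?thesis by blast
qed

private lemma batch:
  "latent_on (B (Suc k)) (B (Suc k), {}, real (card (B (Suc k))))"
  using fin by (intro latent_on_batch) simp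

text \<open>Only the latent sample is random; the loop variables \<open>W\<close> and
  \<open>\<rho>\<close> follow a deterministic recursion. Keeping the items inside
  \<open>seen k\<close> makes the next union disjoint.\<close>

lemma rtbs_state_invariant:
  assumes "s \<in> set_pmf (rtbs_state lam n \<Delta> B k)"
  obtains L where "s = (total_weight lam \<Delta> B k, rho lam n \<Delta> B k, L)" "latent_on (seen k) L"
    "snd (snd L) = rho lam n \<Delta> B k * total_weight lam \<Delta> B k"
  using assms
proof (induction k arbitrary: s thesis)
  case 0
  then show ?case
    by (simp add: total_weight_def rho_def cap_ratio_def latent_on_def)
next
  case (Suc k)
  obtain s0 where s0: "s0 \<in> set_pmf (rtbs_state lam n \<Delta> B k)"
    "s \<in> set_pmf (rtbs_step lam n \<Delta> B (Suc k) s0)"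
    using Suc.prems(2) by auto
  obtain L where L: "s0 = (total_weight lam \<Delta> B k, rho lam n \<Delta> B k, L)" "latent_on (seen k) L"
    "snd (snd L) = rho lam n \<Delta> B k * total_weight lam \<Delta> B k"
    by (rule Suc.IH[OF _ s0(1)])
  let ?r = "rtbs_retention lam n \<Delta> B k" and ?\<rho> = "rho lam n \<Delta> B (Suc k)"
  obtain L1 L0 L' where *: "L1 \<in> set_pmf (downsample L ?r)"
    "L0 \<in> set_pmf (downsample (B (Suc k), {}, real (card (B (Suc k)))) ?\<rho>)"
    "L' \<in> set_pmf (union_latent L0 L1)"
    "s = (total_weight lam \<Delta> B (Suc k), ?\<rho>, L')"
    using s0(2) unfolding L(1) rtbs_step_eq[OF L(2)] by auto
  note d1 = set_pmf_downsample[OF L(2) rtbs_retention_bounds[OF lam n \<Delta>] *(1)]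
  note d0 = set_pmf_downsample[OF batch rho_bounds[OF n] *(2)]
  note u = set_pmf_union_latent[OF d0(1) d1(1) seen_disjoint *(3)]
  have "snd (snd L') = ?\<rho> * card (B (Suc k)) + ?r * (rho lam n \<Delta> B k * total_weight lam \<Delta> B k)"
    using u(2) d0(2) d1(2) L(3) by simp
  \<comment> \<open>The old \<open>\<rho>\<close> in the denominator of \<open>?r\<close> cancels,
    leaving the recursion of the total weight multiplied by the new \<open>\<rho>\<close>.\<close>
  also have "\<dots> = ?\<rho> * total_weight lam \<Delta> B (Suc k)"
    using rho_bounds(1)[OF n, of lam \<Delta> B k]
    by (simp add: rtbs_retention_def total_weight_Suc distrib_left)
  finally show ?case
    using Suc.prems(1)[OF *(4)] u(1) by (simp add: atLeastAtMostSuc_conv)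
qed

text \<open>The value 0 before the arrival of batch \<open>i\<close> lets the induction start at the
  empty state and pass through the arrival at \<open>k = i\<close>.\<close>

lemma expectation_rtbs_state:
  assumes "i \<ge> 1" "x \<in> B i"
  shows "measure_pmf.expectation (rtbs_state lam n \<Delta> B k) (\<lambda>(W, \<rho>, L). latent_incl x L) =
    (if i \<le> k then rho lam n \<Delta> B k * decay lam (age \<Delta> i k) else 0)"
proof (induction k)
  case 0
  show ?case using assms by (simp add: latent_incl_triple incl_pair)
next
  case (Suc k)
  let ?h = "\<lambda>(W :: real, \<rho> :: real, L). latent_incl x L"
  let ?r = "rtbs_retention lam n \<Delta> B k" and ?\<rho> = "rho lam n \<Delta> B (Suc k)"
  have h: "?h = (\<lambda>s. latent_incl x (snd (snd s)))" by auto
  have int: "integrable (measure_pmf p) ?h" for p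
    unfolding h
    by (rule measure_pmf.integrable_const_bound[where B = 2]) (auto simp: latent_incl_bounds)
  have "measure_pmf.expectation (rtbs_state lam n \<Delta> B (Suc k)) ?h =
    measure_pmf.expectation (rtbs_state lam n \<Delta> B k)
      (\<lambda>s. measure_pmf.expectation (rtbs_step lam n \<Delta> B (Suc k) s) ?h)"
    unfolding rtbs_state.simps by (rule expectation_bind_pmf[where c = 2]) (auto simp: latent_incl_bounds)
  also have "\<dots> = measure_pmf.expectation (rtbs_state lam n \<Delta> B k)
      (\<lambda>s. ?\<rho> * indicat_real (B (Suc k)) x + ?r * ?h s)"
  proof (rule expectation_cong_pmf)
    fix s assume "s \<in> set_pmf (rtbs_state lam n \<Delta> B k)"
    then obtain L where L: "s = (total_weight lam \<Delta> B k, rho lam n \<Delta> B k, L)" "latent_on (seen k) L"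
      by (rule rtbs_state_invariant)
    \<comment> \<open>The integrand ignores \<open>W\<close> and \<open>\<rho>\<close>, so they are
      projected away to leave the composition of downsamplings and union.\<close>
    have "measure_pmf.expectation (rtbs_step lam n \<Delta> B (Suc k) s) ?h =
      measure_pmf.expectation (map_pmf (snd \<circ> snd) (rtbs_step lam n \<Delta> B (Suc k) s)) (latent_incl x)"
      by (simp add: h)
    also have "map_pmf (snd \<circ> snd) (rtbs_step lam n \<Delta> B (Suc k) s) =
      downsample L ?r \<bind> (\<lambda>L1. downsample (B (Suc k), {}, real (card (B (Suc k)))) ?\<rho> \<bind> (\<lambda>L0.
        union_latent L0 L1))"
      unfolding L(1) rtbs_step_eq[OF L(2)] by (simp add: map_bind_pmf bind_return_pmf')
    also have "measure_pmf.expectation \<dots> (latent_incl x) =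
      ?\<rho> * indicat_real (B (Suc k)) x + ?r * latent_incl x L"
      unfolding expectation_union_downsampled[OF batch rho_bounds[OF n] L(2)
          rtbs_retention_bounds[OF lam n \<Delta>] seen_disjoint] latent_incl_batch ..
    finally show "measure_pmf.expectation (rtbs_step lam n \<Delta> B (Suc k) s) ?h =
      ?\<rho> * indicat_real (B (Suc k)) x + ?r * ?h s"
      by (simp add: L(1))
  qed
  also have "\<dots> = ?\<rho> * indicat_real (B (Suc k)) x
      + ?r * measure_pmf.expectation (rtbs_state lam n \<Delta> B k) ?h"
    using int by simp
  also have "\<dots> = (if i \<le> Suc k then ?\<rho> * decay lam (age \<Delta> i (Suc k)) else 0)"
  proof -
    \<comment> \<open>Disjointness of the batches makes exactly one summand contribute: the new
      batch at arrival, the retained old weight afterwards.\<close>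
    have "x \<in> B (Suc k) \<longleftrightarrow> i = Suc k"
      using assms disjoint_family_onD[OF disj, of i "Suc k"] by auto
    then show ?thesis
      using rho_bounds(1)[OF n, of lam \<Delta> B k]
      by (cases "i = Suc k")
        (simp_all add: Suc.IH decay_age_self, simp add: decay_age_Suc rtbs_retention_def le_Suc_eq)
  qed
  finally show ?case .
qed

end

section \<open>From inclusion weights to inclusion probabilities\<close>

lemma prob_get_sample:
  assumes "latent_on U L"
  shows "measure_pmf.prob (get_sample L) {S. x \<in> S} = latent_incl x L"
proof -
  obtain A \<pi> C where L: "L = (A, \<pi>, C)" by (metis prod_cases3)
  have "measure_pmf.prob (get_sample L) {S. x \<in> S} =
      measure_pmf.expectation (get_sample L) (indicat_real {S. x \<in> S})"
    by simp
  also have "\<dots> = measure_pmf.expectation (uniform_le (frac C))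
      (\<lambda>u. indicat_real {S. x \<in> S} (if u then A \<union> \<pi> else A))"
    unfolding L get_sample_def prod.case
    by (subst expectation_bind_pmf[where c = 1]) (auto simp: indicator_def)
  \<comment> \<open>Disjointness of \<open>A\<close> and \<open>\<pi>\<close> is what turns
    membership in \<open>A \<union> \<pi>\<close> into a sum of indicators.\<close>
  also have "\<dots> = latent_incl x L"
    using assms by (subst expectation_uniform_le)
      (auto simp: L frac_lt_1 less_imp_le latent_incl_triple incl_pair indicator_def latent_on_def)
  finally show ?thesis .
qed

theorem theorem4p3:
  fixes lam \<Delta> :: real and n :: nat and B :: "nat \<Rightarrow> 'a set"
  assumes "lam \<ge> 0" and "n \<ge> 1" and "\<Delta> > 0"
    and "\<forall>k\<ge>1. finite (B k)"
    and "disjoint_family_on B {1..}"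
  shows
    "(\<forall>k\<ge>1. \<forall>i\<in>{1..k}. \<forall>x\<in>B i.
        measure_pmf.prob (rtbs lam n \<Delta> B k) {(L, S). x \<in> S}
          = rho lam n \<Delta> B k * decay lam (age \<Delta> i k))
     \<and> (\<forall>k\<ge>1. \<forall>((A, \<pi>, C), S) \<in> set_pmf (rtbs lam n \<Delta> B k).
        C = rho lam n \<Delta> B k * total_weight lam \<Delta> B k)
     \<and> (\<forall>k>1. \<forall>i\<in>{1..<k}.
        rho lam n \<Delta> B k * decay lam (age \<Delta> i k)
          \<le> rho lam n \<Delta> B (k - 1) * decay lam (age \<Delta> i (k - 1)))"
proof (intro conjI)
  note inv = rtbs_state_invariant[OF assms]
  have mem: "\<exists>s\<in>set_pmf (rtbs_state lam n \<Delta> B k). L = snd (snd s)"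
    if "(L, S) \<in> set_pmf (rtbs lam n \<Delta> B k)" for L S k
    using that by (force simp: rtbs_def)
  show "\<forall>k\<ge>1. \<forall>((A, \<pi>, C), S) \<in> set_pmf (rtbs lam n \<Delta> B k).
        C = rho lam n \<Delta> B k * total_weight lam \<Delta> B k"
  proof (intro allI impI ballI, clarify)
    fix k A \<pi> C S assume "((A, \<pi>, C), S) \<in> set_pmf (rtbs lam n \<Delta> B k)"
    then obtain s where s: "s \<in> set_pmf (rtbs_state lam n \<Delta> B k)" "(A, \<pi>, C) = snd (snd s)"
      using mem by blast
    obtain L where "s = (total_weight lam \<Delta> B k, rho lam n \<Delta> B k, L)"
      "snd (snd L) = rho lam n \<Delta> B k * total_weight lam \<Delta> B k"
      by (rule inv[OF s(1)])
    then show "C = rho lam n \<Delta> B k * total_weight lam \<Delta> B k"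
      using s(2) by (metis snd_conv)
  qed
  show "\<forall>k>1. \<forall>i\<in>{1..<k}. rho lam n \<Delta> B k * decay lam (age \<Delta> i k)
          \<le> rho lam n \<Delta> B (k - 1) * decay lam (age \<Delta> i (k - 1))"
  proof (intro allI impI ballI)
    fix k i :: nat assume "1 < k"
    then show "rho lam n \<Delta> B k * decay lam (age \<Delta> i k)
          \<le> rho lam n \<Delta> B (k - 1) * decay lam (age \<Delta> i (k - 1))"
      using rho_decay_antimono[OF assms(1,3), of n B "k - 1" i] by simp
  qed
  show "\<forall>k\<ge>1. \<forall>i\<in>{1..k}. \<forall>x\<in>B i.
        measure_pmf.prob (rtbs lam n \<Delta> B k) {(L, S). x \<in> S}
          = rho lam n \<Delta> B k * decay lam (age \<Delta> i k)"
  proof (intro allI impI ballI)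
    fix k i x assume i: "i \<in> {1..k}" and x: "x \<in> B i"
    have "measure_pmf.prob (rtbs lam n \<Delta> B k) {(L, S). x \<in> S} =
      measure_pmf.prob (map_pmf snd (rtbs lam n \<Delta> B k)) {S. x \<in> S}"
      by (simp add: vimage_def case_prod_unfold)
    \<comment> \<open>Forgetting the latent sample leaves one draw from \<open>get_sample\<close> on
      top of the state, so the probability is the mean over states of the conditional inclusion
      probability.\<close>
    also have "map_pmf snd (rtbs lam n \<Delta> B k) =
      rtbs_state lam n \<Delta> B k \<bind> (\<lambda>s. get_sample (snd (snd s)))"
      by (simp add: rtbs_def map_bind_pmf bind_return_pmf' case_prod_unfold)
    also have "measure_pmf.prob \<dots> {S. x \<in> S} = measure_pmf.expectation \<dots> (indicat_real {S. x \<in> S})"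
      by simp
    also have "\<dots> = measure_pmf.expectation (rtbs_state lam n \<Delta> B k)
      (\<lambda>s. measure_pmf.expectation (get_sample (snd (snd s))) (indicat_real {S. x \<in> S}))"
      by (rule expectation_bind_pmf[where c = 1]) (auto simp: indicator_def)
    also have "\<dots> = measure_pmf.expectation (rtbs_state lam n \<Delta> B k) (\<lambda>(W, \<rho>, L). latent_incl x L)"
    proof (rule expectation_cong_pmf)
      fix s assume "s \<in> set_pmf (rtbs_state lam n \<Delta> B k)"
      then obtain L where "s = (total_weight lam \<Delta> B k, rho lam n \<Delta> B k, L)"
        "latent_on (\<Union>i\<in>{1..k}. B i) L"
        by (rule inv)
      then show "measure_pmf.expectation (get_sample (snd (snd s))) (indicat_real {S. x \<in> S}) =
        (case s of (W, \<rho>, L) \<Rightarrow> latent_incl x L)"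
        by (simp add: prob_get_sample)
    qed
    also have "\<dots> = rho lam n \<Delta> B k * decay lam (age \<Delta> i k)"
      using expectation_rtbs_state[OF assms, of i x k] i x by simp
    finally show "measure_pmf.prob (rtbs lam n \<Delta> B k) {(L, S). x \<in> S}
          = rho lam n \<Delta> B k * decay lam (age \<Delta> i k)" .
  qed
qed

end
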